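(* Let $p,q>0$ with $p+q=1$ and $p<q$, and let $\lambda=p/q$. Let $X_n$ be the discrete-time $p$-$q$ random walk on $\mathbb N\cup\{0\}$, $\mathbb N=\{1,2,\dots\}$, absorbed at $0$, with transition probabilities $Q(0,0)=1$, $Q(x,x-1)=q$ and $Q(x,x+1)=p$ for $x\ge1$, and $Q(x,y)=0$ otherwise. Let $S_1=2\mathbb N-1$ (odd positive integers) and $S_2=2\mathbb N$ (even positive integers), and let $$\nu_{\min}(x)=\bigl(1-\sqrt\lambda\bigr)^2\,x\,\bigl(\sqrt\lambda\bigr)^{x-1},\qquad x\ge1.$$ Then, for both $j=1,2$, $$\lim_{n\to\infty}\delta_1T_{2n+j-1}=\nu_{\min}(\,\cdot\,|S_j).$$ Moreover, for $j=1,2$, $\nu_{\min}(\,\cdot\,|S_j)\preccurlyeq\nu(\,\cdot\,|S_j)$ for any other quasi-stationary distribution $\nu$.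
   Context: $\delta_1$ is the probability measure on $\mathbb N$ concentrated at $1$, and $\preccurlyeq$ denotes the stochastic order of probability measures on $\mathbb N$ induced by the usual order. For a probability measure $\nu$ on $\mathbb N$ and $n\ge0$, $\nu T_n(y):=\frac{\nu Q^n(y)}{1-\nu Q^n(0)}$, $y\in\mathbb N$: the law at time $n$ of the chain started from $\nu$, conditioned on not being absorbed at $0$ by time $n$. A probability measure $\nu$ on $\mathbb N$ is a quasi-stationary distribution if $\nu=\nu T_1$. Limits of measures are pointwise on $\mathbb N$. $\nu(\,\cdot\,|S_j)$ denotes $\nu$ conditioned on $S_j$. *)

theory Defs
  imports "HOL-Probability.Probability"
begin

definition walk :: "real \<Rightarrow> nat \<Rightarrow> nat pmf" where
  "walk p x = (if x = 0 then return_pmf 0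
     else map_pmf (\<lambda>b. if b then x + 1 else x - 1) (bernoulli_pmf p))"

lemma pmf_walk:
  assumes "0 \<le> p" "p \<le> 1"
  shows "pmf (walk p x) y =
    (if x = 0 then (if y = 0 then 1 else 0)
     else if y = x + 1 then p else if y = x - 1 then 1 - p else 0)"
proof (cases "x = 0")
  case True
  then show ?thesis by (simp add: walk_def indicator_def)
next
  case False
  let ?f = "\<lambda>b. if b then x + 1 else x - 1"
  have "?f -` {y} = (if y = x + 1 then {True} else if y = x - 1 then {False} else {})"
    using False by (auto split: if_splits)
  then show ?thesis
    using False assms by (simp add: walk_def pmf_map measure_pmf_single)
qed

definition law :: "(nat \<Rightarrow> nat pmf) \<Rightarrow> nat \<Rightarrow> nat pmf \<Rightarrow> nat pmf" where
  "law K n \<nu> = ((\<lambda>\<mu>. bind_pmf \<mu> K) ^^ n) \<nu>"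

text \<open>Mass function on the positive integers of the law at time \<open>n\<close> given non-absorption at
  \<open>0\<close>; the value at \<open>y = 0\<close> is meaningless.\<close>

definition cond_law :: "(nat \<Rightarrow> nat pmf) \<Rightarrow> nat \<Rightarrow> nat pmf \<Rightarrow> nat \<Rightarrow> real" where
  "cond_law K n \<nu> y = pmf (law K n \<nu>) y / (1 - pmf (law K n \<nu>) 0)"

text \<open>A probability measure on the positive integers is a \<open>nat pmf\<close> giving no mass to \<open>0\<close>.\<close>

definition quasi_stationary :: "(nat \<Rightarrow> nat pmf) \<Rightarrow> nat pmf \<Rightarrow> bool" where
  "quasi_stationary K \<nu> \<longleftrightarrow>
     pmf \<nu> 0 = 0 \<and> (\<forall>y\<ge>1. pmf \<nu> y = cond_law K 1 \<nu> y)"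

text \<open>For measures without mass at \<open>0\<close>, testing with functions on \<open>nat\<close> is the same as testing with
  functions on the positive integers: an increasing bounded function extends to \<open>0\<close> by its value
  at \<open>1\<close>.\<close>

definition stoch_le :: "'a::order pmf \<Rightarrow> 'a pmf \<Rightarrow> bool"  (infix "\<preceq>st" 50) where
  "\<mu> \<preceq>st \<nu> \<longleftrightarrow>
     (\<forall>f :: 'a \<Rightarrow> real. mono f \<longrightarrow> bounded (range f) \<longrightarrow>
        measure_pmf.expectation \<mu> f \<le> measure_pmf.expectation \<nu> f)"

text \<open>Only \<open>j = 1\<close> and \<open>j = 2\<close> are intended.\<close>

definition S :: "nat \<Rightarrow> nat set" where
  "S j = (if j = 1 then {x. odd x} else {x. even x \<and> x > 0})"

definition nu_min :: "real \<Rightarrow> nat pmf" where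
  "nu_min lam = embed_pmf (\<lambda>x. (1 - sqrt lam)^2 * real x * sqrt lam ^ (x - 1))"

lemma pmf_nu_min:
  assumes "0 < lam" "lam < 1"
  shows "pmf (nu_min lam) x = (1 - sqrt lam)^2 * real x * sqrt lam ^ (x - 1)"
proof -
  let ?f = "\<lambda>x::nat. (1 - sqrt lam)^2 * real x * sqrt lam ^ (x - 1)"
  have lt: "sqrt lam < 1" and ge: "0 \<le> sqrt lam" using assms by auto
  then have "(\<lambda>n. of_nat (Suc n) * sqrt lam ^ n) sums (1 / (1 - sqrt lam)^2)"
    by (intro geometric_deriv_sums) auto
  from sums_mult[OF this, of "(1 - sqrt lam)^2"]
  have "(\<lambda>n. ?f (Suc n)) sums 1"
    using lt by (simp add: mult.assoc)
  then have "?f sums 1"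
    using sums_Suc_iff[of ?f 1] by simp
  moreover have nonneg: "0 \<le> ?f x" for x using ge by simp
  ultimately have "(\<Sum>x. ennreal (?f x)) = ennreal 1"
    by (intro suminf_ennreal_eq)
  then have "(\<integral>\<^sup>+x. ennreal (?f x) \<partial>count_space UNIV) = 1"
    unfolding nn_integral_count_space_nat ennreal_1 .
  then show ?thesis
    unfolding nu_min_def by (rule pmf_embed_pmf[OF nonneg])
qed

lemma pmf_bind_walk:
  assumes "0 \<le> p" "p \<le> 1"
  shows "pmf (bind_pmf \<nu> (walk p)) y =
    (if y = 0 then pmf \<nu> 0 + (1 - p) * pmf \<nu> 1
     else (if y = 1 then 0 else p * pmf \<nu> (y - 1)) + (1 - p) * pmf \<nu> (y + 1))"
proof -
  let ?a = "if y = 0 then 1 else if y = 1 then 0 else p"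
  have eq: "pmf (walk p x) y = ?a * indicator {y - 1} x + (1 - p) * indicator {y + 1} x" for x
    using assms by (auto simp: pmf_walk indicator_def)
  have ind: "measure_pmf.expectation \<nu> (indicator {x}) = pmf \<nu> x" for x
    using Bochner_Integration.integral_indicator[of "measure_pmf \<nu>" "{x}"]
    by (simp only: measure_pmf_single space_measure_pmf Int_UNIV_right)
  have int: "integrable (measure_pmf \<nu>) (\<lambda>x. c * indicator {z} x :: real)" for c z
    by (rule measure_pmf.integrable_const_bound[where B = "\<bar>c\<bar>"])
       (auto simp: indicator_def)
  have "pmf (bind_pmf \<nu> (walk p)) y =
      measure_pmf.expectation \<nu> (\<lambda>x. ?a * indicator {y - 1} x + (1 - p) * indicator {y + 1} x)"
    by (simp only: pmf_bind eq)
  also have "\<dots> = ?a * measure_pmf.expectation \<nu> (indicator {y - 1})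
      + (1 - p) * measure_pmf.expectation \<nu> (indicator {y + 1})"
    by (simp only: Bochner_Integration.integral_add[OF int int] integral_mult_right_zero)
  also have "\<dots> = ?a * pmf \<nu> (y - 1) + (1 - p) * pmf \<nu> (y + 1)"
    by (simp only: ind)
  finally show ?thesis by auto
qed

lemma quasi_stationary_walk_iff:
  assumes "0 < p" "p < 1"
  shows "quasi_stationary (walk p) \<nu> \<longleftrightarrow> pmf \<nu> 0 = 0 \<and>
    (\<forall>y\<ge>1. (1 - (1 - p) * pmf \<nu> 1) * pmf \<nu> y =
       (if y = 1 then 0 else p * pmf \<nu> (y - 1)) + (1 - p) * pmf \<nu> (y + 1))"
proof -
  have "(1 - p) * pmf \<nu> 1 \<le> (1 - p) * 1"
    using assms by (intro mult_left_mono pmf_le_1) auto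
  also have "\<dots> < 1" using assms by simp
  finally have pos: "1 - (1 - p) * pmf \<nu> 1 \<noteq> 0" by simp
  show ?thesis
  proof (cases "pmf \<nu> 0 = 0")
    case True
    have cl: "cond_law (walk p) 1 \<nu> y =
        ((if y = 1 then 0 else p * pmf \<nu> (y - 1)) + (1 - p) * pmf \<nu> (y + 1))
          / (1 - (1 - p) * pmf \<nu> 1)" if "y \<ge> 1" for y
      using assms that True by (simp add: cond_law_def law_def pmf_bind_walk)
    have "pmf \<nu> y = cond_law (walk p) 1 \<nu> y \<longleftrightarrow> (1 - (1 - p) * pmf \<nu> 1) * pmf \<nu> y =
        (if y = 1 then 0 else p * pmf \<nu> (y - 1)) + (1 - p) * pmf \<nu> (y + 1)"
      if "y \<ge> 1" for y
      by (simp only: cl[OF that] nonzero_eq_divide_eq[OF pos] mult.commute[of "pmf \<nu> y"])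
    with True show ?thesis
      unfolding quasi_stationary_def by blast
  qed (simp add: quasi_stationary_def)
qed

text \<open>\<open>cond_pmf\<close> is only meaningful when the conditioning set is charged.\<close>

lemma quasi_stationary_charges_S:
  assumes "0 < p" "p < 1" "quasi_stationary (walk p) \<nu>"
  shows "set_pmf \<nu> \<inter> S j \<noteq> {}"
proof -
  have z: "pmf \<nu> 0 = 0"
    and e: "\<And>y. y \<ge> 1 \<Longrightarrow> (1 - (1 - p) * pmf \<nu> 1) * pmf \<nu> y =
       (if y = 1 then 0 else p * pmf \<nu> (y - 1)) + (1 - p) * pmf \<nu> (y + 1)"
    using assms by (auto simp: quasi_stationary_walk_iff)
  obtain x where x: "x \<in> set_pmf \<nu>" using set_pmf_not_empty[of \<nu>] by blast
  then have px: "pmf \<nu> x > 0" by (rule pmf_positive)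
  with z have x0: "x > 0" by (cases x) auto
  have "p * pmf \<nu> x > 0" and "(1 - p) * pmf \<nu> (x + 2) \<ge> 0"
    using px assms by auto
  with e[of "x + 1"] x0 have "pmf \<nu> (x + 1) \<noteq> 0" by auto
  then have "x + 1 \<in> set_pmf \<nu>" by (simp add: set_pmf_iff)
  then show ?thesis using x x0 by (cases "even x"; cases "j = 1") (auto simp: S_def)
qed

lemma quasi_stationary_nu_min:
  assumes "0 < p" "0 < q" "p + q = 1" "p < q"
  shows "quasi_stationary (walk p) (nu_min (p / q))"
proof -
  define s where "s = sqrt (p / q)"
  have lam: "0 < p / q" "p / q < 1" using assms by auto
  have "s^2 = p / q" unfolding s_def using lam by (intro real_sqrt_pow2) simp
  then have p: "p = q * s^2" using assms by simp
  have q1: "q * s^2 + q = 1" using p assms(3) by metis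
  have m: "pmf (nu_min (p / q)) x = (1 - s)^2 * real x * s ^ (x - 1)" for x
    using pmf_nu_min[OF lam] by (simp add: s_def)
  have c: "1 - q * (1 - s)^2 = 2 * q * s"
    using q1 by (simp add: power2_diff algebra_simps)
  have q: "1 - p = q" using assms by simp
  have e: "2 * q * s * ((1 - s)^2 * real y * s ^ (y - 1)) =
      (if y = 1 then 0 else p * ((1 - s)^2 * real (y - 1) * s ^ (y - 1 - 1)))
      + q * ((1 - s)^2 * real (y + 1) * s ^ (y + 1 - 1))" if "y \<ge> 1" for y
  proof (cases "y = 1")
    case True
    then show ?thesis by simp
  next
    case False
    with that obtain k where "y = Suc (Suc k)" by (metis One_nat_def Suc_le_D not0_implies_Suc)
    then show ?thesis by (simp add: p power2_eq_square algebra_simps)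
  qed
  have m0: "pmf (nu_min (p / q)) 0 = 0" and m1: "pmf (nu_min (p / q)) 1 = (1 - s)^2"
    by (simp_all add: m)
  have "0 < p" "p < 1" using assms by auto
  then show ?thesis
    unfolding quasi_stationary_walk_iff[OF \<open>0 < p\<close> \<open>p < 1\<close>] m1 q c
    using m0 e unfolding m by blast
qed

end

theory Submission imports Defs "HOL-Real_Asymp.Real_Asymp" begin

text \<open>Write \<open>s = sqrt (p / q)\<close>. By the ballot theorem the walk started at \<open>1\<close> has at time \<open>n\<close> a mass
  at \<open>y > 0\<close> proportional to \<open>y * s ^ y\<close> times the binomial coefficient
  \<open>(n + 1) choose ((n + 1 - y) div 2)\<close>, for \<open>y\<close> of the right parity. Divided by the central
  binomial coefficient, the latter is bounded by 1 and tends to 1, so dominated convergence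
  (Tannery) gives the limit.

  For a quasi-stationary \<open>\<nu>\<close>, the sequence \<open>v y = \<nu> y / s ^ y\<close> satisfies
  \<open>v (y + 1) = \<beta> * v y - v (y - 1)\<close>, and positivity forces \<open>\<beta> \<ge> 2\<close>. Hence \<open>v\<close> is convex with
  \<open>v 0 = 0\<close>, so \<open>v y / y\<close> increases: \<open>\<nu>\<close> dominates \<open>\<nu>\<^sub>m\<^sub>i\<^sub>n\<close> in the likelihood ratio order, which
  survives conditioning and implies the stochastic order.\<close>

section \<open>Likelihood ratio order\<close>

text \<open>Points where \<open>\<mu>\<close> has the larger mass never lie above points where
  \<open>\<nu>\<close> does, so a level \<open>K\<close> separates the values of \<open>f\<close> on
  these two sets. Both total masses being 1, \<open>f\<close> may be replaced by
  \<open>f - K\<close>, and then every term of the difference of expectations is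
  nonnegative.\<close>

lemma stoch_le_if_likelihood_ratio:
  fixes \<mu> \<nu> :: "'a::linorder pmf"
  assumes lr: "\<And>x y. x < y \<Longrightarrow> pmf \<mu> y * pmf \<nu> x \<le> pmf \<mu> x * pmf \<nu> y"
  shows "\<mu> \<preceq>st \<nu>"
  unfolding stoch_le_def
proof (intro allI impI)
  fix f :: "'a \<Rightarrow> real"
  assume f: "mono f" "bounded (range f)"
  then obtain B where B: "\<And>x. \<bar>f x\<bar> \<le> B"
    unfolding bounded_iff by auto
  define P where "P = {x. pmf \<mu> x < pmf \<nu> x}"
  \<comment> \<open>An infimum, because \<open>P\<close> need not have a least element; for empty
    \<open>P\<close> any upper bound of \<open>f\<close> serves.\<close>
  define K where "K = (if P = {} then B else Inf (f ` P))"
  have bdd: "bdd_below (f ` P)"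
    by (rule bdd_belowI2[of _ "- B"]) (use B abs_le_D2 minus_le_iff in blast)
  have above: "K \<le> f x" if "x \<in> P" for x
    using that bdd unfolding K_def by (auto intro: cInf_lower)
  have below: "f y \<le> K" if y: "pmf \<nu> y < pmf \<mu> y" for y
  proof (cases "P = {}")
    case True
    then show ?thesis using B[of y] by (simp add: K_def)
  next
    case False
    have "f y \<le> f x" if "x \<in> P" for x
    proof (rule monoD[OF \<open>mono f\<close>], rule ccontr)
      assume "\<not> y \<le> x"
      then have "pmf \<mu> y * pmf \<nu> x \<le> pmf \<mu> x * pmf \<nu> y" by (intro lr) simp
      also have "\<dots> \<le> pmf \<mu> x * pmf \<mu> y" using y by (intro mult_left_mono) auto
      also have "\<dots> < pmf \<nu> x * pmf \<mu> y"
        using that y by (intro mult_strict_right_mono) (auto simp: P_def intro: le_less_trans[OF pmf_nonneg])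
      finally show False by (simp add: mult.commute)
    qed
    then show ?thesis using False unfolding K_def by (auto intro: cInf_greatest)
  qed
  have term_nonneg: "0 \<le> (pmf \<nu> x - pmf \<mu> x) * (f x - K)" for x
    using above[of x] below[of x]
    by (cases "pmf \<mu> x" "pmf \<nu> x" rule: linorder_cases)
       (auto simp: P_def intro: mult_nonpos_nonpos)
  have int: "integrable (measure_pmf \<rho>) f" for \<rho> :: "'a pmf"
    by (rule measure_pmf.integrable_const_bound[where B = B]) (use B in auto)
  \<comment> \<open>Over the counting measure the two expectations can be subtracted term by
    term.\<close>
  have int': "integrable (count_space UNIV) (\<lambda>x. pmf \<rho> x * (f x - K))" for \<rho> :: "'a pmf"
  proof -
    have "integrable (measure_pmf \<rho>) (\<lambda>x. f x - K)" using int by simp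
    then show ?thesis unfolding measure_pmf_eq_density by (subst (asm) integrable_density) auto
  qed
  have eq: "measure_pmf.expectation \<rho> f - K = (\<integral>x. pmf \<rho> x * (f x - K) \<partial>count_space UNIV)"
    for \<rho> :: "'a pmf"
  proof -
    have "measure_pmf.expectation \<rho> f - K = measure_pmf.expectation \<rho> (\<lambda>x. f x - K)"
      using int by simp
    also have "\<dots> = (\<integral>x. pmf \<rho> x * (f x - K) \<partial>count_space UNIV)"
      unfolding measure_pmf_eq_density by (subst integral_density) auto
    finally show ?thesis .
  qed
  have "0 \<le> (\<integral>x. (pmf \<nu> x - pmf \<mu> x) * (f x - K) \<partial>count_space UNIV)"
    by (intro Bochner_Integration.integral_nonneg term_nonneg)
  also have "\<dots> = (measure_pmf.expectation \<nu> f - K) - (measure_pmf.expectation \<mu> f - K)"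
    unfolding eq left_diff_distrib by (rule Bochner_Integration.integral_diff[OF int' int'])
  finally show "measure_pmf.expectation \<mu> f \<le> measure_pmf.expectation \<nu> f" by simp
qed

text \<open>Conditioning rescales each mass function on \<open>A\<close> and kills it elsewhere, so
  inside \<open>A\<close> the cross-multiplied inequality is merely divided by
  \<open>measure \<mu> A * measure \<nu> A\<close>.\<close>

lemma stoch_le_cond_pmf_if_likelihood_ratio:
  fixes \<mu> \<nu> :: "'a::linorder pmf"
  assumes lr: "\<And>x y. x < y \<Longrightarrow> pmf \<mu> y * pmf \<nu> x \<le> pmf \<mu> x * pmf \<nu> y"
    and ne: "set_pmf \<mu> \<inter> A \<noteq> {}" "set_pmf \<nu> \<inter> A \<noteq> {}"
  shows "cond_pmf \<mu> A \<preceq>st cond_pmf \<nu> A"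
proof (rule stoch_le_if_likelihood_ratio)
  fix x y :: 'a
  assume "x < y"
  from divide_right_mono[OF lr[OF this], of "measure \<mu> A * measure \<nu> A"]
  show "pmf (cond_pmf \<mu> A) y * pmf (cond_pmf \<nu> A) x
      \<le> pmf (cond_pmf \<mu> A) x * pmf (cond_pmf \<nu> A) y"
    using ne by (simp add: pmf_cond mult.commute)
qed

section \<open>Quasi-stationary distributions\<close>

text \<open>Ratios of consecutive terms satisfy \<open>r (Suc n) = \<beta> - 1 / r n\<close>. Since
  \<open>r n + 1 / r n\<close> is at least 2, for \<open>\<beta> < 2\<close> they would drop by at
  least \<open>2 - \<beta>\<close> at each step and turn negative.\<close>

lemma positive_recurrence_coeff_ge_2:
  fixes v :: "nat \<Rightarrow> real"
  assumes pos: "\<And>n. v (Suc n) > 0"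
    and rec: "\<And>n. v (n + 2) = \<beta> * v (n + 1) - v n"
  shows "\<beta> \<ge> 2"
proof (rule ccontr)
  assume "\<not> \<beta> \<ge> 2"
  then have d: "2 - \<beta> > 0" by simp
  \<comment> \<open>The ratios start at index 1, as \<open>v 0\<close> is 0 in the
    application.\<close>
  define r where "r n = v (n + 2) / v (n + 1)" for n
  have r_pos: "r n > 0" for n using pos[of n] pos[of "Suc n"] by (simp add: r_def)
  have step: "r (Suc n) \<le> r n - (2 - \<beta>)" for n
  proof -
    have "r (Suc n) = \<beta> - 1 / r n"
      using rec[of "Suc n"] pos[of n] pos[of "Suc n"] by (simp add: r_def field_simps)
    moreover have "2 \<le> r n + 1 / r n"
      using r_pos[of n] zero_le_power2[of "r n - 1"] by (simp add: field_simps power2_eq_square)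
    ultimately show ?thesis by simp
  qed
  have "r n \<le> r 0 - real n * (2 - \<beta>)" for n
  proof (induction n)
    case (Suc n)
    then show ?case using step[of n] by (simp add: algebra_simps)
  qed simp
  moreover obtain n where "r 0 < real n * (2 - \<beta>)"
    using d ex_less_of_nat_mult by blast
  ultimately have "r n < 0" by (smt (verit))
  then show False using r_pos[of n] by simp
qed

text \<open>The quotients are slopes of chords from the origin. The induction uses the
  cross-multiplied form, which is meaningful at 0 too.\<close>

lemma convex_seq_ratio_mono:
  fixes v :: "nat \<Rightarrow> real"
  assumes "v 0 = 0" and conv: "\<And>n. 2 * v (n + 1) \<le> v n + v (n + 2)"
    and "0 < x" "x \<le> y"
  shows "v x / real x \<le> v y / real y"
proof -
  have *: "real (n + 1) * v n \<le> real n * v (n + 1)" for n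
  proof (induction n)
    case 0
    then show ?case using \<open>v 0 = 0\<close> by simp
  next
    case (Suc n)
    have "0 \<le> real (n + 1) * (v n + v (n + 2) - 2 * v (n + 1))" using conv[of n] by simp
    with Suc show ?case by (simp add: algebra_simps)
  qed
  \<comment> \<open>Passing to successors keeps the conventional value of \<open>v 0 / 0\<close> out
    of the chain.\<close>
  have "v (Suc n) / real (Suc n) \<le> v (Suc (Suc n)) / real (Suc (Suc n))" for n
    using *[of "Suc n"] by (simp add: field_simps)
  then have "v (Suc m) / real (Suc m) \<le> v (Suc n) / real (Suc n)" if "m \<le> n" for m n
    by (rule lift_Suc_mono_le) (rule that)
  from this[of "x - 1" "y - 1"] show ?thesis using assms(3,4) by simp
qed

text \<open>At a zero of the mass function the eigenvector equation forces both nonnegative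
  neighbouring terms to vanish, so zeros would spread everywhere, contradicting total mass
  1.\<close>

lemma quasi_stationary_walk_pos:
  assumes p: "0 < p" "p < 1" and qs: "quasi_stationary (walk p) \<nu>"
  shows "pmf \<nu> (Suc n) > 0"
proof (rule ccontr)
  assume "\<not> ?thesis"
  then have z: "pmf \<nu> (Suc n) = 0" using pmf_nonneg[of \<nu> "Suc n"] by linarith
  have z0: "pmf \<nu> 0 = 0"
    and e: "\<And>y. y \<ge> 1 \<Longrightarrow> (1 - (1 - p) * pmf \<nu> 1) * pmf \<nu> y =
       (if y = 1 then 0 else p * pmf \<nu> (y - 1)) + (1 - p) * pmf \<nu> (y + 1)"
    using qs p by (auto simp: quasi_stationary_walk_iff)
  have up: "pmf \<nu> (Suc (Suc k)) = 0" if "pmf \<nu> (Suc k) = 0" for k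
    using e[of "Suc k"] that p pmf_nonneg[of \<nu> k] pmf_nonneg[of \<nu> "Suc (Suc k)"]
    by (auto simp: add_nonneg_eq_0_iff split: if_splits)
  have down: "pmf \<nu> (Suc k) = 0" if "pmf \<nu> (Suc (Suc k)) = 0" for k
    using e[of "Suc (Suc k)"] that p by (auto simp: add_nonneg_eq_0_iff)
  have "pmf \<nu> (Suc 0) = 0" using z by (induction n) (auto dest: down)
  then have "pmf \<nu> (Suc k) = 0" for k by (induction k) (auto dest: up)
  with z0 have "pmf \<nu> k = 0" for k by (cases k) auto
  then show False using set_pmf_not_empty[of \<nu>] by (auto simp: set_pmf_iff)
qed

text \<open>For \<open>p < q\<close> the denominators are proportional to the masses of
  \<open>nu_min (p / q)\<close>, so this is monotonicity of the likelihood ratio.\<close>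

lemma quasi_stationary_walk_ratio_mono:
  assumes p: "0 < p" "0 < q" "p + q = 1" and qs: "quasi_stationary (walk p) \<nu>"
    and xy: "0 < x" "x \<le> y"
  shows "pmf \<nu> x / (real x * sqrt (p / q) ^ x) \<le> pmf \<nu> y / (real y * sqrt (p / q) ^ y)"
proof -
  define s where "s = sqrt (p / q)"
  have s: "s > 0" "s * s = p / q" using p by (simp_all add: s_def)
  have p1: "0 < p" "p < 1" and q: "1 - p = q" using p by auto
  define v where "v n = pmf \<nu> n / s ^ n" for n
  \<comment> \<open>The numerator is the one-step survival probability, which is the eigenvalue of
    \<open>\<nu>\<close>.\<close>
  define \<beta> where "\<beta> = (1 - q * pmf \<nu> 1) / (q * s)"
  have z0: "pmf \<nu> 0 = 0"
    and e: "\<And>y. y \<ge> 1 \<Longrightarrow> (1 - q * pmf \<nu> 1) * pmf \<nu> y =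
       (if y = 1 then 0 else p * pmf \<nu> (y - 1)) + q * pmf \<nu> (y + 1)"
    using qs p1 q by (auto simp: quasi_stationary_walk_iff)
  \<comment> \<open>This identity is why scaling by \<open>s ^ n\<close> turns the coefficient of
    \<open>v n\<close> into -1.\<close>
  have pq: "p = q * (s * s)" using s p by simp
  have rec: "v (n + 2) = \<beta> * v (n + 1) - v n" for n
  proof -
    have "(1 - q * pmf \<nu> 1) * pmf \<nu> (n + 1) = q * (s * s) * pmf \<nu> n + q * pmf \<nu> (n + 2)"
      using e[of "n + 1"] z0 pq by (cases "n = 0") auto
    then have "pmf \<nu> (n + 2) = ((1 - q * pmf \<nu> 1) * pmf \<nu> (n + 1) - q * (s * s) * pmf \<nu> n) / q"
      using p by (simp add: field_simps)
    moreover have "(t * a - q * (s * s) * b) / q / s ^ (n + 2)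
        = t / (q * s) * (a / s ^ (n + 1)) - b / s ^ n" for t a b
      using s(1) p by (simp add: diff_divide_distrib power_add)
    ultimately show ?thesis unfolding v_def \<beta>_def by metis
  qed
  have pos: "v (Suc n) > 0" for n
    using quasi_stationary_walk_pos[OF p1 qs, of n] s by (simp add: v_def)
  have v0: "v 0 = 0" using z0 by (simp add: v_def)
  have "\<beta> \<ge> 2" using pos rec by (rule positive_recurrence_coeff_ge_2)
  then have "2 * v (n + 1) \<le> v n + v (n + 2)" for n
    using rec[of n] mult_right_mono[of 2 \<beta> "v (n + 1)"] pos[of n] by simp
  from convex_seq_ratio_mono[of v, OF v0 this xy] show ?thesis
    by (simp add: v_def s_def mult.commute)
qed

lemma nu_min_likelihood_ratio:
  assumes p: "0 < p" "0 < q" "p + q = 1" "p < q" and qs: "quasi_stationary (walk p) \<nu>"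
    and "x < y"
  shows "pmf (nu_min (p / q)) y * pmf \<nu> x \<le> pmf (nu_min (p / q)) x * pmf \<nu> y"
proof (cases "x = 0")
  case True
  then show ?thesis using qs by (simp add: quasi_stationary_def)
next
  case False
  have lam: "0 < p / q" "p / q < 1" using p by auto
  define s where "s = sqrt (p / q)"
  have s: "s > 0" using p by (simp add: s_def)
  \<comment> \<open>Trading \<open>s ^ (n - 1)\<close> for \<open>s ^ n\<close> costs a factor
    \<open>1 / s\<close>; at \<open>n = 0\<close> both sides vanish.\<close>
  have m: "pmf (nu_min (p / q)) n = (1 - s)\<^sup>2 / s * (real n * s ^ n)" for n
    using s unfolding pmf_nu_min[OF lam] s_def[symmetric] by (cases n) simp_all
  have "real y * s ^ y * pmf \<nu> x \<le> real x * s ^ x * pmf \<nu> y"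
    using quasi_stationary_walk_ratio_mono[OF p(1-3) qs, of x y] False \<open>x < y\<close> s
    by (simp add: s_def[symmetric] divide_le_eq le_divide_eq mult_ac)
  from mult_left_mono[OF this, of "(1 - s)\<^sup>2 / s"] show ?thesis
    using s unfolding m by (simp add: mult.assoc)
qed

section \<open>The law of the walk started at 1\<close>

text \<open>The right side counts paths of length \<open>n + 1\<close> from 1 to \<open>y\<close>
  that avoid 0 and have \<open>k\<close> down-steps; the left side splits them by the last step.
  Absorption identities express all binomials through \<open>(n + 2) choose k\<close>.\<close>

lemma ballot_recurrence:
  assumes "y + 2 * k = n + 2" "y > 0"
  shows "(real y - 1) / (real n + 1) * real ((n + 1) choose k)
      + (if k = 0 then 0 else (real y + 1) / (real n + 1) * real ((n + 1) choose (k - 1)))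
    = real y / (real n + 2) * real ((n + 2) choose k)"
proof -
  define C where "C = real ((n + 2) choose k)"
  have "(n + 2 - k) * ((n + 2) choose k) = (n + 2) * ((n + 1) choose k)"
    using binomial_absorb_comp[of "n + 2" k] by simp
  then have "real (n + 2 - k) * C = (real n + 2) * real ((n + 1) choose k)"
    unfolding C_def by (metis of_nat_mult of_nat_add of_nat_numeral)
  moreover have "real (n + 2 - k) = real y + real k"
    using assms by linarith
  ultimately have "(real y + real k) * C = (real n + 2) * real ((n + 1) choose k)"
    by (simp only:)
  then have A: "real ((n + 1) choose k) = (real y + real k) * C / (real n + 2)"
    by simp
  have B: "real ((n + 1) choose (k - 1)) = real k * C / (real n + 2)" if "k \<noteq> 0"
  proof -
    from that obtain a where a: "k = Suc a" by (cases k) auto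
    have "k * ((n + 2) choose k) = (n + 2) * ((n + 1) choose (k - 1))"
      using Suc_times_binomial[of a "n + 1"] a by simp
    then have "real k * C = (real n + 2) * real ((n + 1) choose (k - 1))"
      unfolding C_def by (metis of_nat_mult of_nat_add of_nat_numeral)
    then show ?thesis by (simp add: field_simps)
  qed
  have n: "real n = real y + 2 * real k - 2" using assms by linarith
  have "(real y - 1) * ((real y + real k) * C) + (real y + 1) * (real k * C)
      = real y * (real n + 1) * C"
    unfolding n by (simp add: algebra_simps)
  then have "((real y - 1) * ((real y + real k) * C) + (real y + 1) * (real k * C))
      / ((real n + 1) * (real n + 2)) = real y * C / (real n + 2)"
    by simp
  then have "(real y - 1) / (real n + 1) * ((real y + real k) * C / (real n + 2))
      + (real y + 1) / (real n + 1) * (real k * C / (real n + 2))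
    = real y * C / (real n + 2)"
    by (simp only: times_divide_times_eq add_divide_distrib[symmetric])
  then show ?thesis using A B C_def by (cases "k = 0") simp_all
qed

lemma law_Suc: "law K (Suc n) \<nu> = bind_pmf (law K n \<nu>) K"
  by (simp add: law_def)

text \<open>Here \<open>k\<close> counts down-steps and \<open>k + y - 1\<close> up-steps. Both
  claims share one induction, because the case \<open>k = 0\<close> needs \<open>y + 1\<close> to be
  unreachable one step earlier.\<close>

lemma pmf_law_walk:
  assumes p: "0 < p" "0 < q" "p + q = 1" and "y > 0"
  shows "y + 2 * k = n + 1 \<Longrightarrow> pmf (law (walk p) n (return_pmf 1)) y
      = real y / (real n + 1) * real ((n + 1) choose k) * p ^ (k + y - 1) * q ^ k"
    and "(\<And>k. y + 2 * k \<noteq> n + 1) \<Longrightarrow> pmf (law (walk p) n (return_pmf 1)) y = 0"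
  using \<open>y > 0\<close>
proof (induction n arbitrary: y k)
  case 0
  {
    case 1
    then have "y = 1" "k = 0" by auto
    then show ?case by (simp add: law_def)
  next
    case 2
    from 2(1)[of 0] show ?case by (simp add: law_def)
  }
next
  case (Suc n)
  let ?L = "\<lambda>n. pmf (law (walk p) n (return_pmf 1))"
  have p1: "0 \<le> p" "p \<le> 1" and q: "1 - p = q" using p by auto
  have step: "?L (Suc n) y = (if y = 1 then 0 else p * ?L n (y - 1)) + q * ?L n (y + 1)"
    if "y > 0" for y
    using that q by (simp add: law_Suc pmf_bind_walk[OF p1])
  {
    case 1
    \<comment> \<open>For \<open>y = 1\<close> the factor \<open>real y - 1\<close> vanishes,
      matching the fact that nothing returns from 0.\<close>
    have down: "(if y = 1 then 0 else p * ?L n (y - 1))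
        = (real y - 1) / (real n + 1) * real ((n + 1) choose k) * (p ^ (k + y - 1) * q ^ k)"
    proof (cases "y = 1")
      case False
      then obtain z where z: "y = Suc (Suc z)" using \<open>0 < y\<close> by (metis Suc_pred' neq0_conv One_nat_def)
      then show ?thesis using Suc.IH(1)[of "y - 1" k] 1 by simp
    qed simp
    have up: "q * ?L n (y + 1) = (if k = 0 then 0
        else (real y + 1) / (real n + 1) * real ((n + 1) choose (k - 1))) * (p ^ (k + y - 1) * q ^ k)"
    proof (cases k)
      case 0
      then show ?thesis using Suc.IH(2)[of "y + 1"] 1 by simp
    next
      case (Suc a)
      then show ?thesis using Suc.IH(1)[of "y + 1" a] 1 by (simp add: add.commute)
    qed
    have "?L (Suc n) y = ((real y - 1) / (real n + 1) * real ((n + 1) choose k)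
      + (if k = 0 then 0 else (real y + 1) / (real n + 1) * real ((n + 1) choose (k - 1))))
      * (p ^ (k + y - 1) * q ^ k)"
      unfolding step[OF \<open>0 < y\<close>] down up by (simp only: distrib_right)
    also have "\<dots> = real y / (real n + 2) * real ((n + 2) choose k) * (p ^ (k + y - 1) * q ^ k)"
      using ballot_recurrence[of y k n] 1 by simp
    finally show ?case by (simp add: add.commute mult.assoc)
  next
    case 2
    have "?L n (y - 1) = 0" if "y \<noteq> 1"
    proof (rule Suc.IH(2))
      show "y - 1 + 2 * k \<noteq> n + 1" for k using 2(1)[of k] \<open>0 < y\<close> by linarith
    qed (use that \<open>0 < y\<close> in simp)
    moreover have "?L n (y + 1) = 0"
    proof (rule Suc.IH(2))
      show "y + 1 + 2 * k \<noteq> n + 1" for k using 2(1)[of "Suc k"] by simp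
    qed simp
    ultimately show ?case using step[OF \<open>0 < y\<close>] by simp
  }
qed

section \<open>Binomial coefficients relative to the central one\<close>

text \<open>The subtraction \<open>m - l\<close> is truncated: the product vanishes for \<open>i > m\<close>, as the binomial
  coefficient it represents should.\<close>

definition binomial_ratio :: "nat \<Rightarrow> nat \<Rightarrow> nat \<Rightarrow> real" where
  "binomial_ratio j m i = (\<Prod>l<i. real (m - l) / real (m + j + l + 1))"

text \<open>Each factor of the product is the quotient of the binomial coefficients with lower
  indices \<open>m - l - 1\<close> and \<open>m - l\<close>.\<close>

lemma binomial_ratio:
  "i \<le> m \<Longrightarrow> real ((2 * m + j) choose (m - i)) = real ((2 * m + j) choose m) * binomial_ratio j m i"
proof (induction i)
  case 0
  then show ?case by (simp add: binomial_ratio_def)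
next
  case (Suc i)
  define a where "a = m - Suc i"
  have a: "Suc a = m - i" "Suc (a + (m + j + i)) = 2 * m + j" using Suc.prems by (auto simp: a_def)
  have "Suc a * (Suc (a + (m + j + i)) choose Suc a)
      = Suc (m + j + i) * (Suc (a + (m + j + i)) choose a)"
    by (rule Suc_times_binomial_add)
  then have "(m - i) * ((2 * m + j) choose (m - i)) = (m + j + i + 1) * ((2 * m + j) choose a)"
    unfolding a by simp
  then have "real (m - i) * real ((2 * m + j) choose (m - i))
      = real (m + j + i + 1) * real ((2 * m + j) choose a)"
    by (metis of_nat_mult)
  moreover have "real (m + j + i + 1) \<noteq> 0" by linarith
  ultimately have "real ((2 * m + j) choose a)
      = real ((2 * m + j) choose (m - i)) * (real (m - i) / real (m + j + i + 1))"
    by (simp add: field_simps del: of_nat_add of_nat_Suc)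
  then show ?case using Suc by (simp add: a_def binomial_ratio_def mult.assoc)
qed

lemma binomial_ratio_eq_0: "m < i \<Longrightarrow> binomial_ratio j m i = 0"
  unfolding binomial_ratio_def by (rule prod_zero) auto

lemma binomial_ratio_bounds: "0 \<le> binomial_ratio j m i" "binomial_ratio j m i \<le> 1"
  unfolding binomial_ratio_def by (auto intro!: prod_nonneg prod_le_1 simp: divide_le_eq)

lemma binomial_ratio_tendsto: "(\<lambda>m. binomial_ratio j m i) \<longlonglongrightarrow> 1"
proof -
  have "(\<lambda>m. real (m - l) / real (m + j + l + 1)) \<longlonglongrightarrow> 1" for l
  proof (rule Lim_transform_eventually)
    have "(\<lambda>m. (real m - real l) / (real m + real j + real l + 1)) \<longlonglongrightarrow> 1" by real_asymp
    then show "(\<lambda>m. (real m - real l) / real (m + j + l + 1)) \<longlonglongrightarrow> 1"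
      by (simp add: add_ac)
    show "\<forall>\<^sub>F m in sequentially. (real m - real l) / real (m + j + l + 1)
        = real (m - l) / real (m + j + l + 1)"
      using eventually_ge_at_top[of l] by eventually_elim (simp add: of_nat_diff)
  qed
  then have "(\<lambda>m. binomial_ratio j m i) \<longlonglongrightarrow> (\<Prod>l<i. 1)"
    unfolding binomial_ratio_def by (intro tendsto_prod)
  then show ?thesis by simp
qed

section \<open>Conditional laws on a parity class\<close>

lemma S_eq: "j \<in> {1, 2} \<Longrightarrow> S j = range (\<lambda>i. 2 * i + j)"
  by (auto simp: S_def image_def elim!: oddE evenE) presburger+

lemma pmf_sums_measure_S:
  assumes "j \<in> {1, 2}"
  shows "(\<lambda>i. pmf \<mu> (2 * i + j)) sums measure \<mu> (S j)"
proof -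
  have "(\<lambda>i. measure \<mu> {2 * i + j}) sums measure \<mu> (\<Union>i. {2 * i + j})"
    by (rule measure_pmf.finite_measure_UNION) (auto simp: disjoint_family_on_def)
  then show ?thesis using S_eq[OF assms] by (simp add: measure_pmf_single UNION_singleton_eq_range)
qed

text \<open>At this time the walk is at 0 or in \<open>S j\<close>, so conditioning on survival
  normalises the mass on \<open>S j\<close>. The prefactor \<open>c\<close>, independent of
  \<open>i\<close>, then cancels.\<close>

lemma cond_law_walk_eq:
  assumes p: "0 < p" "0 < q" "p + q = 1" and j: "j \<in> {1, 2}"
  defines "h \<equiv> \<lambda>m i. real (2 * i + j) * (p / q) ^ i * binomial_ratio j m i"
  shows "cond_law (walk p) (2 * m + j - 1) (return_pmf 1) (2 * i + j) = h m i / (\<Sum>i. h m i)"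
    and "y > 0 \<Longrightarrow> y \<notin> S j \<Longrightarrow> cond_law (walk p) (2 * m + j - 1) (return_pmf 1) y = 0"
proof -
  define \<mu> where "\<mu> = law (walk p) (2 * m + j - 1) (return_pmf 1)"
  define c where "c = real ((2 * m + j) choose m) * (p * q) ^ m * p ^ (j - 1) / real (2 * m + j)"
  have j0: "j > 0" and n: "2 * m + j - 1 + 1 = 2 * m + j" using j by auto
  then have rn: "real (2 * m + j - 1) + 1 = real (2 * m + j)" by linarith
  have out: "pmf \<mu> y = 0" if "y > 0" "y \<notin> S j" for y
    unfolding \<mu>_def
  proof (rule pmf_law_walk(2)[OF p \<open>y > 0\<close>])
    fix k
    show "y + 2 * k \<noteq> 2 * m + j - 1 + 1"
      using that j unfolding n S_def by (auto split: if_splits) presburger+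
  qed
  then show "y > 0 \<Longrightarrow> y \<notin> S j \<Longrightarrow> cond_law (walk p) (2 * m + j - 1) (return_pmf 1) y = 0"
    by (simp add: cond_law_def \<mu>_def)
  have mass: "pmf \<mu> (2 * i + j) = c * h m i" for i
  proof (cases "i \<le> m")
    case True
    then have "pmf \<mu> (2 * i + j) = real (2 * i + j) / real (2 * m + j)
        * real ((2 * m + j) choose (m - i)) * p ^ (m - i + (2 * i + j) - 1) * q ^ (m - i)"
      unfolding \<mu>_def using pmf_law_walk(1)[OF p, of "2 * i + j" "m - i" "2 * m + j - 1"] j0
      unfolding n rn by simp
    also have "m - i + (2 * i + j) - 1 = m + i + (j - 1)" using True j0 by simp
    also have "q ^ (m - i) = q ^ m / q ^ i" using True p by (simp add: power_diff)
    finally show ?thesis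
      unfolding binomial_ratio[OF True] c_def h_def
      by (simp add: power_add power_mult_distrib power_divide field_simps)
  next
    \<comment> \<open>Such a site is too far to be reached by this time, and
      \<open>binomial_ratio\<close> vanishes accordingly.\<close>
    case False
    then show ?thesis
      unfolding \<mu>_def using pmf_law_walk(2)[OF p, of "2 * i + j" "2 * m + j - 1"] j0
      unfolding n by (simp add: h_def binomial_ratio_eq_0)
  qed
  have c: "c > 0" unfolding c_def using p j0 by simp
  have "1 - pmf \<mu> 0 = measure \<mu> (- {0})"
    using measure_pmf.prob_compl[of "{0}" \<mu>] by (simp add: measure_pmf_single Compl_eq_Diff_UNIV)
  also have "\<dots> = measure \<mu> (S j)"
  proof (rule measure_pmf.finite_measure_eq_AE)
    have "y \<in> - {0} \<longleftrightarrow> y \<in> S j" if "y \<in> set_pmf \<mu>" for y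
    proof -
      have "y \<in> S j" if "y \<noteq> 0" using that \<open>y \<in> set_pmf \<mu>\<close> out[of y] by (auto simp: set_pmf_iff)
      moreover have "y \<notin> S j" if "y = 0" unfolding that S_def by simp
      ultimately show ?thesis by blast
    qed
    then show "AE y in \<mu>. y \<in> - {0} \<longleftrightarrow> y \<in> S j" by (simp add: AE_measure_pmf_iff)
  qed auto
  finally have "1 - pmf \<mu> 0 = measure \<mu> (S j)" .
  moreover have "(\<lambda>i. c * h m i) sums measure \<mu> (S j)"
    using pmf_sums_measure_S[OF j, of \<mu>] by (simp add: mass)
  from sums_divide[OF this, of c] have "(\<Sum>i. h m i) = measure \<mu> (S j) / c"
    using c by (simp add: sums_iff)
  ultimately show "cond_law (walk p) (2 * m + j - 1) (return_pmf 1) (2 * i + j) = h m i / (\<Sum>i. h m i)"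
    using c unfolding cond_law_def \<mu>_def[symmetric] mass by simp
qed

text \<open>These are the weights of \<open>cond_law_walk_eq\<close> with the binomial ratio
  replaced by its limit 1; within a parity class \<open>sqrt lam ^ (2 * i)\<close> is
  \<open>lam ^ i\<close>.\<close>

lemma pmf_cond_nu_min:
  assumes lam: "0 < lam" "lam < 1" and j: "j \<in> {1, 2}"
  defines "h \<equiv> \<lambda>i. real (2 * i + j) * lam ^ i"
  shows "set_pmf (nu_min lam) \<inter> S j \<noteq> {}"
    and "pmf (cond_pmf (nu_min lam) (S j)) (2 * i + j) = h i / (\<Sum>i. h i)"
    and "summable h" "(\<Sum>i. h i) > 0"
proof -
  define c where "c = (1 - sqrt lam)\<^sup>2 * sqrt lam ^ (j - 1)"
  have c: "c > 0" using lam unfolding c_def by simp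
  have mass: "pmf (nu_min lam) (2 * i + j) = c * h i" for i
  proof -
    have "2 * i + j - 1 = 2 * i + (j - 1)" using j by auto
    moreover have "sqrt lam ^ (2 * i) = lam ^ i" using lam by (simp add: power_mult)
    ultimately show ?thesis
      unfolding pmf_nu_min[OF lam] c_def h_def by (simp add: power_add)
  qed
  have h: "h i > 0" for i unfolding h_def using lam j by auto
  have jS: "2 * i + j \<in> S j" for i using S_eq[OF j] by auto
  show ne: "set_pmf (nu_min lam) \<inter> S j \<noteq> {}"
    using jS[of 0] mass[of 0] c h[of 0] by (metis disjoint_iff set_pmf_iff add_0 mult_0_right mult_pos_pos less_irrefl)
  have "(\<lambda>i. c * h i) sums measure (nu_min lam) (S j)"
    using pmf_sums_measure_S[OF j, of "nu_min lam"] by (simp add: mass)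
  from sums_divide[OF this, of c] have s: "h sums (measure (nu_min lam) (S j) / c)"
    using c by simp
  then show "summable h" by (simp add: sums_iff)
  then show "(\<Sum>i. h i) > 0" using h by (intro suminf_pos) auto
  show "pmf (cond_pmf (nu_min lam) (S j)) (2 * i + j) = h i / (\<Sum>i. h i)"
    using s c jS[of i] ne by (simp add: pmf_cond mass sums_iff)
qed

theorem corollary10:
  fixes p q lam :: real
  assumes "p > 0" and "q > 0" and "p + q = 1" and "p < q"
    and "lam = p / q"
  shows "(\<forall>j\<in>{1, 2}. \<forall>y\<ge>1.
            (\<lambda>n. cond_law (walk p) (2 * n + j - 1) (return_pmf 1) y)
              \<longlonglongrightarrow> pmf (cond_pmf (nu_min lam) (S j)) y)
       \<and> (\<forall>j\<in>{1, 2}. \<forall>\<nu>. quasi_stationary (walk p) \<nu> \<and> \<nu> \<noteq> nu_min lam \<longrightarrow>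
            cond_pmf (nu_min lam) (S j) \<preceq>st cond_pmf \<nu> (S j))"
proof (intro conjI ballI allI impI)
  fix j y :: nat
  assume j: "j \<in> {1, 2}" and y: "1 \<le> y"
  have lam: "0 < lam" "lam < 1" using assms by auto
  note nm = pmf_cond_nu_min[OF lam j]
  show "(\<lambda>n. cond_law (walk p) (2 * n + j - 1) (return_pmf 1) y)
      \<longlonglongrightarrow> pmf (cond_pmf (nu_min lam) (S j)) y"
  proof (cases "y \<in> S j")
    \<comment> \<open>At a site of the wrong parity both the sequence and its limit are 0.\<close>
    case False
    then show ?thesis using y cond_law_walk_eq(2)[OF assms(1-3) j, of y] nm(1) by (simp add: pmf_cond)
  next
    case True
    then obtain i where i: "y = 2 * i + j" using S_eq[OF j] by auto
    define h where "h i = real (2 * i + j) * lam ^ i" for i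
    have lim: "(\<lambda>m. h i * binomial_ratio j m i) \<longlonglongrightarrow> h i" for i
      using tendsto_mult_left[OF binomial_ratio_tendsto, of "h i"] by simp
    have "(\<lambda>m. \<Sum>i. h i * binomial_ratio j m i) \<longlonglongrightarrow> (\<Sum>i. h i)"
    \<comment> \<open>Since the binomial ratio lies between 0 and 1, the summable \<open>h\<close>
      dominates and the limit passes through the normalising sum.\<close>
    proof (rule tannerys_theorem[THEN conjunct2, THEN conjunct2])
      show "\<forall>\<^sub>F (i, m) in at_top \<times>\<^sub>F sequentially. norm (h i * binomial_ratio j m i) \<le> h i"
      proof (rule always_eventually, safe)
        fix i m
        have "h i \<ge> 0" using lam by (simp add: h_def)
        then show "norm (h i * binomial_ratio j m i) \<le> h i"
          using binomial_ratio_bounds[of j m i] by (simp add: abs_mult mult_left_le)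
      qed
      show "summable h" using nm(3) by (simp add: h_def[abs_def])
    qed (use lim in auto)
    from tendsto_divide[OF lim[of i] this] have
      "(\<lambda>m. h i * binomial_ratio j m i / (\<Sum>i. h i * binomial_ratio j m i)) \<longlonglongrightarrow> h i / (\<Sum>i. h i)"
      using nm(4) by (simp add: h_def)
    then show ?thesis
      unfolding i cond_law_walk_eq(1)[OF assms(1-3) j] nm(2) assms(5)[symmetric] h_def .
  qed
next
  fix j :: nat and \<nu>
  assume j: "j \<in> {1, 2}" and qs: "quasi_stationary (walk p) \<nu> \<and> \<nu> \<noteq> nu_min lam"
  have p: "0 < p" "p < 1" using assms by auto
  show "cond_pmf (nu_min lam) (S j) \<preceq>st cond_pmf \<nu> (S j)"
  proof (rule stoch_le_cond_pmf_if_likelihood_ratio)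
    show "set_pmf (nu_min lam) \<inter> S j \<noteq> {}"
      by (rule pmf_cond_nu_min(1)) (use assms j in auto)
    show "set_pmf \<nu> \<inter> S j \<noteq> {}"
      using quasi_stationary_charges_S[OF p] qs by blast
  qed (use nu_min_likelihood_ratio[OF assms(1-4)] qs assms(5) in blast)
qed

end
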